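(* Let $(X,d,\mu,\mathcal E,\mathcal F)$ be a sub-Gaussian Dirichlet space with parameters $d_H,d_W$. For every $\lambda>0$, $$KS^{\lambda,1}(X)=\mathcal{KS}^{\lambda,1}(X)=\mathbf B^{1,\frac{\lambda}{d_W}}(X).$$ Moreover, $\mathcal{KS}^{\lambda,1}(X)$ and $\mathbf B^{1,\lambda/d_W}(X)$ have equivalent norms, i.e. $\|f\|_{\mathcal{KS}^{\lambda,1}(X)}$ and $\|f\|_{1,\lambda/d_W}$ are comparable, with constants independent of $f$.
   Context: A sub-Gaussian Dirichlet space $(X,d,\mu,\mathcal E,\mathcal F)$ with parameters $d_H,d_W$ means: $(X,d,\mu)$ is a locally compact metric measure space, $\mu$ is a Radon measure with support $X$, $(\mathcal E,\mathcal F)$ is a Dirichlet form on $L^2(X,\mu)$, and (i) every ball $B(x,r)=\{y: d(x,y)<r\}$, $x\in X$, $0<r<\infty$, has compact closure; (ii) $\mu$ is Ahlfors $d_H$-regular: there are $c_1,c_2,d_H\in(0,\infty)$ with $c_1r^{d_H}\le\mu(B(x,r))\le c_2r^{d_H}$ for all $x\in X$, $r\in[0,\infty)$; (iii) $\mathcal E$ is regular and strongly local (i.e. $\mathcal E(u,v)=0$ for $u,v\in\mathcal F$ with compact supports such that $u$ is constant in a neighborhood of the support of $v$); (iv) the heat semigroup $\{P_t\}$ of $(\mathcal E,\mathcal F)$ has a continuous heat kernel $p_t(x,y)$ satisfying, for some $c_3,c_4,c_5,c_6\in(0,\infty)$ and $d_W\in(2,\infty)$, $$c_5t^{-d_H/d_W}\exp\Big(-c_6\Big(\tfrac{d(x,y)^{d_W}}{t}\Big)^{\frac1{d_W-1}}\Big)\le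 p_t(x,y)\le c_3t^{-d_H/d_W}\exp\Big(-c_4\Big(\tfrac{d(x,y)^{d_W}}{t}\Big)^{\frac1{d_W-1}}\Big)$$ for $\mu\times\mu$-a.e. $(x,y)$ and all $t>0$. In this setting $P_t1=1$. Let $\Delta_r=\{(x,y)\in X\times X: d(x,y)<r\}$. For $\lambda>0$, $KS^{\lambda,1}(X)$ is the set of $f\in L^1(X,\mu)$ with $$\|f\|_{KS^{\lambda,1}(X)}:=\limsup_{r\to0^+}\iint_{\Delta_r}\frac{|f(y)-f(x)|}{r^\lambda\mu(B(x,r))}\,d\mu(y)\,d\mu(x)<\infty,$$ and $\mathcal{KS}^{\lambda,1}(X)$ is the set of $f\in L^1(X,\mu)$ with $$\|f\|_{\mathcal{KS}^{\lambda,1}(X)}:=\sup_{r>0}\iint_{\Delta_r}\frac{|f(y)-f(x)|}{r^\lambda\mu(B(x,r))}\,d\mu(y)\,d\mu(x)<\infty.$$ For $\alpha\ge0$, $\|f\|_{1,\alpha}:=\sup_{t>0}t^{-\alpha}\int_X\int_X|f(x)-f(y)|p_t(x,y)\,d\mu(x)\,d\mu(y)$ and $\mathbf B^{1,\alpha}(X)=\{f\in L^1(X,\mu):\|f\|_{1,\alpha}<\infty\}$. *)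

theory Defs
  imports "HOL-Analysis.Analysis"
begin

section \<open>Radon measures and \<open>L\<^sup>2\<close>\<close>

definition radon_measure :: "'a::t2_space measure \<Rightarrow> bool" where
  "radon_measure M \<longleftrightarrow>
     sets M = sets borel \<and>
     (\<forall>K. compact K \<longrightarrow> emeasure M K < \<infinity>) \<and>
     (\<forall>A\<in>sets M. emeasure M A = (INF U\<in>{U. open U \<and> A \<subseteq> U}. emeasure M U)) \<and>
     (\<forall>U. open U \<longrightarrow> emeasure M U = (SUP K\<in>{K. compact K \<and> K \<subseteq> U}. emeasure M K))"

definition measure_support :: "'a::topological_space measure \<Rightarrow> 'a set" where
  "measure_support M = {x. \<forall>U. open U \<longrightarrow> x \<in> U \<longrightarrow> 0 < emeasure M U}"

text \<open>Elements of \<open>L\<^sup>2\<close> are represented by functions; almost everywhere equal functions are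
  identified by requiring all notions below to be invariant under a.e. equality.\<close>

definition L2_space :: "'a measure \<Rightarrow> ('a \<Rightarrow> real) set" where
  "L2_space M = {f \<in> borel_measurable M. integrable M (\<lambda>x. (f x)\<^sup>2)}"

definition L2_inner :: "'a measure \<Rightarrow> ('a \<Rightarrow> real) \<Rightarrow> ('a \<Rightarrow> real) \<Rightarrow> real" where
  "L2_inner M f g = (\<integral>x. f x * g x \<partial>M)"

definition L2_norm :: "'a measure \<Rightarrow> ('a \<Rightarrow> real) \<Rightarrow> real" where
  "L2_norm M f = sqrt (L2_inner M f f)"

section \<open>Dirichlet forms\<close>

text \<open>The form norm is the one of \<open>\<E>\<^sub>1(u,u) = \<E>(u,u) + \<parallel>u\<parallel>\<^sup>2\<close>.\<close>

definition form_norm ::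
  "'a measure \<Rightarrow> (('a \<Rightarrow> real) \<Rightarrow> ('a \<Rightarrow> real) \<Rightarrow> real) \<Rightarrow> ('a \<Rightarrow> real) \<Rightarrow> real" where
  "form_norm M E u = sqrt (E u u + L2_inner M u u)"

locale dirichlet_form =
  fixes M :: "'a measure"
    and E :: "('a \<Rightarrow> real) \<Rightarrow> ('a \<Rightarrow> real) \<Rightarrow> real"
    and F :: "('a \<Rightarrow> real) set"
  assumes domain_L2: "F \<subseteq> L2_space M"
    and domain_AE: "\<lbrakk>u \<in> F; v \<in> borel_measurable M; AE x in M. u x = v x\<rbrakk> \<Longrightarrow> v \<in> F"
    and domain_zero: "(\<lambda>x. 0) \<in> F"
    and domain_add: "\<lbrakk>u \<in> F; v \<in> F\<rbrakk> \<Longrightarrow> (\<lambda>x. u x + v x) \<in> F"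
    and domain_scale: "u \<in> F \<Longrightarrow> (\<lambda>x. c * u x) \<in> F"
    and domain_dense: "\<lbrakk>f \<in> L2_space M; 0 < e\<rbrakk> \<Longrightarrow> \<exists>u\<in>F. L2_norm M (\<lambda>x. f x - u x) < e"
    and form_AE: "\<lbrakk>u \<in> F; u' \<in> F; AE x in M. u x = u' x; v \<in> F\<rbrakk> \<Longrightarrow> E u v = E u' v"
    and form_sym: "\<lbrakk>u \<in> F; v \<in> F\<rbrakk> \<Longrightarrow> E u v = E v u"
    and form_add: "\<lbrakk>u \<in> F; v \<in> F; w \<in> F\<rbrakk> \<Longrightarrow> E (\<lambda>x. u x + v x) w = E u w + E v w"
    and form_scale: "\<lbrakk>u \<in> F; v \<in> F\<rbrakk> \<Longrightarrow> E (\<lambda>x. c * u x) v = c * E u v"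
    and form_nonneg: "u \<in> F \<Longrightarrow> 0 \<le> E u u"
    and form_closed:
      "\<lbrakk>\<forall>n. seq n \<in> F;
        \<forall>e>0. \<exists>N. \<forall>m\<ge>N. \<forall>n\<ge>N. form_norm M E (\<lambda>x. seq m x - seq n x) < e\<rbrakk>
       \<Longrightarrow> \<exists>v\<in>F. (\<lambda>n. form_norm M E (\<lambda>x. seq n x - v x)) \<longlonglongrightarrow> 0"
    and markovian_domain: "u \<in> F \<Longrightarrow> (\<lambda>x. min (max (u x) 0) 1) \<in> F"
    and markovian:
      "u \<in> F \<Longrightarrow> E (\<lambda>x. min (max (u x) 0) 1) (\<lambda>x. min (max (u x) 0) 1) \<le> E u u"

definition Cc_space :: "('a::topological_space \<Rightarrow> real) set" where
  "Cc_space = {f. continuous_on UNIV f \<and> compact (closure {x. f x \<noteq> 0})}"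

definition regular_form ::
  "'a::topological_space measure \<Rightarrow> (('a \<Rightarrow> real) \<Rightarrow> ('a \<Rightarrow> real) \<Rightarrow> real) \<Rightarrow> ('a \<Rightarrow> real) set \<Rightarrow> bool" where
  "regular_form M E F \<longleftrightarrow>
     (\<forall>u\<in>F. \<forall>e>0. \<exists>g\<in>F \<inter> Cc_space. form_norm M E (\<lambda>x. u x - g x) < e) \<and>
     (\<forall>f\<in>Cc_space. \<forall>e>0. \<exists>g\<in>F \<inter> Cc_space. \<forall>x. \<bar>f x - g x\<bar> < e)"

text \<open>The support of an a.e. class: the complement of the union of all open sets on which the
  function vanishes a.e.\<close>

definition AE_support :: "'a::topological_space measure \<Rightarrow> ('a \<Rightarrow> real) \<Rightarrow> 'a set" where
  "AE_support M u = - \<Union>{U. open U \<and> (AE x in M. x \<in> U \<longrightarrow> u x = 0)}"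

definition strongly_local_form ::
  "'a::topological_space measure \<Rightarrow> (('a \<Rightarrow> real) \<Rightarrow> ('a \<Rightarrow> real) \<Rightarrow> real) \<Rightarrow> ('a \<Rightarrow> real) set \<Rightarrow> bool" where
  "strongly_local_form M E F \<longleftrightarrow>
     (\<forall>u\<in>F. \<forall>v\<in>F. compact (AE_support M u) \<longrightarrow> compact (AE_support M v) \<longrightarrow>
        (\<exists>U c. open U \<and> AE_support M v \<subseteq> U \<and> (AE x in M. x \<in> U \<longrightarrow> u x = c)) \<longrightarrow>
        E u v = 0)"

section \<open>Heat semigroup and heat kernel\<close>

text \<open>\<open>form_generator M E F u f\<close> means that \<open>u\<close> lies in the domain of the generator \<open>L\<close> of the
  form, and that \<open>L u = f\<close>.\<close>

definition form_generator ::
  "'a measure \<Rightarrow> (('a \<Rightarrow> real) \<Rightarrow> ('a \<Rightarrow> real) \<Rightarrow> real) \<Rightarrow> ('a \<Rightarrow> real) set \<Rightarrow>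
   ('a \<Rightarrow> real) \<Rightarrow> ('a \<Rightarrow> real) \<Rightarrow> bool" where
  "form_generator M E F u f \<longleftrightarrow>
     u \<in> F \<and> f \<in> L2_space M \<and> (\<forall>v\<in>F. E u v = - L2_inner M f v)"

text \<open>The strongly continuous contraction semigroup on \<open>L\<^sup>2\<close> whose infinitesimal generator is the
  generator of the form. By the Hille--Yosida theorem these conditions determine \<open>P t f\<close> up to
  a.e. equality for \<open>t \<ge> 0\<close> and \<open>f\<close> in \<open>L\<^sup>2\<close>.\<close>

locale heat_semigroup =
  fixes M :: "'a measure"
    and E :: "('a \<Rightarrow> real) \<Rightarrow> ('a \<Rightarrow> real) \<Rightarrow> real"
    and F :: "('a \<Rightarrow> real) set"
    and P :: "real \<Rightarrow> ('a \<Rightarrow> real) \<Rightarrow> 'a \<Rightarrow> real"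
  assumes semigroup_L2: "\<lbrakk>0 \<le> t; f \<in> L2_space M\<rbrakk> \<Longrightarrow> P t f \<in> L2_space M"
    and semigroup_add: "\<lbrakk>0 \<le> t; f \<in> L2_space M; g \<in> L2_space M\<rbrakk>
           \<Longrightarrow> AE x in M. P t (\<lambda>x. f x + g x) x = P t f x + P t g x"
    and semigroup_scale: "\<lbrakk>0 \<le> t; f \<in> L2_space M\<rbrakk> \<Longrightarrow> AE x in M. P t (\<lambda>x. c * f x) x = c * P t f x"
    and semigroup_contraction: "\<lbrakk>0 \<le> t; f \<in> L2_space M\<rbrakk> \<Longrightarrow> L2_norm M (P t f) \<le> L2_norm M f"
    and semigroup_zero: "f \<in> L2_space M \<Longrightarrow> AE x in M. P 0 f x = f x"
    and semigroup_mult: "\<lbrakk>0 \<le> s; 0 \<le> t; f \<in> L2_space M\<rbrakk>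
           \<Longrightarrow> AE x in M. P (s + t) f x = P s (P t f) x"
    and semigroup_continuous: "f \<in> L2_space M
           \<Longrightarrow> ((\<lambda>t. L2_norm M (\<lambda>x. P t f x - f x)) \<longlongrightarrow> 0) (at_right 0)"
    and semigroup_generator: "\<lbrakk>u \<in> L2_space M; f \<in> L2_space M\<rbrakk> \<Longrightarrow>
           ((\<lambda>t. L2_norm M (\<lambda>x. (P t u x - u x) / t - f x)) \<longlongrightarrow> 0) (at_right 0)
             \<longleftrightarrow> form_generator M E F u f"

definition heat_kernel ::
  "'a measure \<Rightarrow> (('a \<Rightarrow> real) \<Rightarrow> ('a \<Rightarrow> real) \<Rightarrow> real) \<Rightarrow> ('a \<Rightarrow> real) set \<Rightarrow>
   (real \<Rightarrow> 'a \<Rightarrow> 'a \<Rightarrow> real) \<Rightarrow> bool" where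
  "heat_kernel M E F p \<longleftrightarrow>
     (\<forall>t>0. (\<lambda>(x, y). p t x y) \<in> borel_measurable (M \<Otimes>\<^sub>M M)) \<and>
     (\<exists>P. heat_semigroup M E F P \<and>
        (\<forall>t>0. \<forall>f\<in>L2_space M. AE x in M.
           integrable M (\<lambda>y. p t x y * f y) \<and> P t f x = (\<integral>y. p t x y * f y \<partial>M)))"

section \<open>Sub-Gaussian Dirichlet spaces\<close>

text \<open>The metric space is the whole type. The heat kernel \<open>p\<close> is a parameter because the heat
  semigroup based Besov seminorm refers to it; it is determined by the form, since it is continuous
  and \<open>M\<close> has full support.\<close>

locale sub_gaussian_dirichlet_space = dirichlet_form M E F
  for M :: "'a::metric_space measure"
    and E :: "('a \<Rightarrow> real) \<Rightarrow> ('a \<Rightarrow> real) \<Rightarrow> real"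
    and F :: "('a \<Rightarrow> real) set"
    and p :: "real \<Rightarrow> 'a \<Rightarrow> 'a \<Rightarrow> real"
    and d\<^sub>H d\<^sub>W :: real +
  assumes locally_compact: "locally compact (UNIV :: 'a set)"
    and radon: "radon_measure M"
    and full_support: "measure_support M = UNIV"
    and compact_closure_ball: "0 < r \<Longrightarrow> compact (closure (ball (x :: 'a) r))"
    and d\<^sub>H_pos: "0 < d\<^sub>H"
    and ahlfors_regular:
      "\<exists>c\<^sub>1>0. \<exists>c\<^sub>2>0. \<forall>x. \<forall>r\<ge>0.
         ennreal (c\<^sub>1 * r powr d\<^sub>H) \<le> emeasure M (ball x r) \<and>
         emeasure M (ball x r) \<le> ennreal (c\<^sub>2 * r powr d\<^sub>H)"
    and regular: "regular_form M E F"
    and strongly_local: "strongly_local_form M E F"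
    and kernel: "heat_kernel M E F p"
    and kernel_continuous: "continuous_on ({0<..} \<times> UNIV) (\<lambda>(t, x, y). p t x y)"
    and d\<^sub>W_gt_2: "2 < d\<^sub>W"
    and sub_gaussian_bounds:
      "\<exists>c\<^sub>3>0. \<exists>c\<^sub>4>0. \<exists>c\<^sub>5>0. \<exists>c\<^sub>6>0. AE (x, y) in M \<Otimes>\<^sub>M M. \<forall>t>0.
         c\<^sub>5 * t powr (- d\<^sub>H / d\<^sub>W) * exp (- c\<^sub>6 * (dist x y powr d\<^sub>W / t) powr (1 / (d\<^sub>W - 1))) \<le> p t x y \<and>
         p t x y \<le> c\<^sub>3 * t powr (- d\<^sub>H / d\<^sub>W) * exp (- c\<^sub>4 * (dist x y powr d\<^sub>W / t) powr (1 / (d\<^sub>W - 1)))"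

section \<open>Korevaar--Schoen and heat semigroup based Besov spaces\<close>

text \<open>All (semi)norms take values in \<open>[0, \<infinity>]\<close>.\<close>

definition near_diagonal :: "real \<Rightarrow> ('a::metric_space \<times> 'a) set" where
  "near_diagonal r = {(x, y). dist x y < r}"

definition KS_energy :: "'a::metric_space measure \<Rightarrow> real \<Rightarrow> ('a \<Rightarrow> real) \<Rightarrow> real \<Rightarrow> ennreal" where
  "KS_energy M l f r =
     (\<integral>\<^sup>+x. (\<integral>\<^sup>+y. ennreal \<bar>f y - f x\<bar> / (ennreal (r powr l) * emeasure M (ball x r))
                    * indicator (near_diagonal r) (x, y) \<partial>M) \<partial>M)"

definition KS_limsup_norm :: "'a::metric_space measure \<Rightarrow> real \<Rightarrow> ('a \<Rightarrow> real) \<Rightarrow> ennreal" where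
  "KS_limsup_norm M l f = Limsup (at_right 0) (KS_energy M l f)"

definition KS_limsup_space :: "'a::metric_space measure \<Rightarrow> real \<Rightarrow> ('a \<Rightarrow> real) set" where
  "KS_limsup_space M l = {f. integrable M f \<and> KS_limsup_norm M l f < \<infinity>}"

definition KS_sup_norm :: "'a::metric_space measure \<Rightarrow> real \<Rightarrow> ('a \<Rightarrow> real) \<Rightarrow> ennreal" where
  "KS_sup_norm M l f = (SUP r\<in>{0<..}. KS_energy M l f r)"

definition KS_sup_space :: "'a::metric_space measure \<Rightarrow> real \<Rightarrow> ('a \<Rightarrow> real) set" where
  "KS_sup_space M l = {f. integrable M f \<and> KS_sup_norm M l f < \<infinity>}"

definition besov_norm ::
  "'a measure \<Rightarrow> (real \<Rightarrow> 'a \<Rightarrow> 'a \<Rightarrow> real) \<Rightarrow> real \<Rightarrow> ('a \<Rightarrow> real) \<Rightarrow> ennreal" where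
  "besov_norm M p \<alpha> f =
     (SUP t\<in>{0<..}. ennreal (t powr (- \<alpha>)) *
        (\<integral>\<^sup>+y. (\<integral>\<^sup>+x. ennreal (\<bar>f x - f y\<bar> * p t x y) \<partial>M) \<partial>M))"

definition besov_space ::
  "'a measure \<Rightarrow> (real \<Rightarrow> 'a \<Rightarrow> 'a \<Rightarrow> real) \<Rightarrow> real \<Rightarrow> ('a \<Rightarrow> real) set" where
  "besov_space M p \<alpha> = {f. integrable M f \<and> besov_norm M p \<alpha> f < \<infinity>}"

end

theory Submission
  imports Defs "HOL-Real_Asymp.Real_Asymp"
begin

text \<open>Write \<open>W r\<close> for the integral of \<open>\<bar>f x - f y\<bar>\<close> over \<open>dist x y < r\<close>. By Ahlfors regularity the
  Korevaar--Schoen energy at scale \<open>r\<close> is comparable to \<open>r powr (- l - d\<^sub>H) * W r\<close>. The lower heat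
  kernel bound at time \<open>t = r powr d\<^sub>W\<close> controls \<open>W r\<close> by the heat semigroup energy. Conversely, the
  upper bound dominates \<open>p t\<close> by a rapidly decaying series of multiples of the indicators of
  \<open>dist x y < 2 ^ k * t powr (1 / d\<^sub>W)\<close>. Finally, by Fubini the energies at scales \<open>r \<ge> \<delta>\<close> are bounded
  by a multiple of the \<open>L\<^sup>1\<close> norm, so that only small scales matter for membership.\<close>

lemma inverse_antimono_ennreal: "x \<le> y \<Longrightarrow> inverse y \<le> inverse (x :: ennreal)"
  unfolding less_eq_ennreal.rep_eq inverse_ennreal.rep_eq by (rule ereal_inverse_antimono) auto

text \<open>The heat kernel bounds hold for almost every pair, while the Besov energy has
  \<open>y\<close> as its outer variable. Flipping the coordinates carries one product measure to
  the other, so either variable can be taken as the outer one.\<close>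

lemma (in pair_sigma_finite) AE_pair_swap:
  assumes "AE (x, y) in M1 \<Otimes>\<^sub>M M2. Q x y"
  shows "AE y in M2. AE x in M1. Q x y"
proof -
  interpret Q: pair_sigma_finite M2 M1 ..
  have "AE w in distr (M2 \<Otimes>\<^sub>M M1) (M1 \<Otimes>\<^sub>M M2) (\<lambda>(x, y). (y, x)). Q (fst w) (snd w)"
    using assms by (subst distr_pair_swap[symmetric]) (simp add: case_prod_beta)
  from AE_distrD[OF measurable_pair_swap' this]
  have "AE w in M2 \<Otimes>\<^sub>M M1. Q (snd w) (fst w)"
    by (simp add: case_prod_beta)
  from Q.AE_pair[OF this] show ?thesis by simp
qed

section \<open>Ahlfors regular spaces with relatively compact balls\<close>

text \<open>The metric measure part of the setting, detached from the form. The regularity constants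
  are parameters so that the estimates below can name them; \<open>h\<close> is the
  dimension.\<close>

locale ahlfors_regular_space =
  fixes M :: "'a::metric_space measure" and h c\<^sub>1 c\<^sub>2 :: real
  assumes sets_M: "sets M = sets borel"
    and compact_closure_ball: "0 < r \<Longrightarrow> compact (closure (ball (x :: 'a) r))"
    and c\<^sub>1_pos: "0 < c\<^sub>1" and c\<^sub>2_pos: "0 < c\<^sub>2"
    and ball_lower: "0 < r \<Longrightarrow> ennreal (c\<^sub>1 * r powr h) \<le> emeasure M (ball x r)"
    and ball_upper: "0 < r \<Longrightarrow> emeasure M (ball x r) \<le> ennreal (c\<^sub>2 * r powr h)"
begin

lemma space_M: "space M = UNIV"
  using sets_eq_imp_space_eq[OF sets_M] by simp

lemma open_in_sets: "open U \<Longrightarrow> U \<in> sets M"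
  by (simp add: sets_M)

lemma ex_ball: "\<exists>n. dist x (y :: 'a) < real (Suc n)"
proof -
  obtain n where "dist x y < real n"
    using reals_Archimedean2 by blast
  then show ?thesis
    by (intro exI[of _ n]) simp
qed

sublocale sigma_finite_measure M
proof
  fix x :: 'a
  have "(\<Union>n. ball x (real (Suc n))) = UNIV"
    using ex_ball[of x] by (auto simp del: of_nat_Suc)
  moreover have "emeasure M (ball x (real (Suc n))) \<noteq> \<infinity>" for n
    using le_less_trans[OF ball_upper ennreal_less_top, of "real (Suc n)" x] by simp
  ultimately show "\<exists>A. countable A \<and> A \<subseteq> sets M \<and> \<Union>A = space M \<and> (\<forall>a\<in>A. emeasure M a \<noteq> \<infinity>)"
    unfolding space_M
    by (intro exI[of _ "range (\<lambda>n. ball x (real (Suc n)))"]) (simp add: image_subset_iff open_in_sets)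
qed

sublocale pair_sigma_finite M M ..

section \<open>Separability and measurability of the near diagonal\<close>

text \<open>Balls have compact closure, hence are totally bounded. The finite nets of mesh
  \<open>1 / Suc m\<close> for the balls of radius \<open>Suc n\<close>, collected over all
  \<open>n\<close> and \<open>m\<close>, form a countable dense set.\<close>

lemma separable:
  obtains D :: "'a set" where "countable D" "\<And>x e. 0 < e \<Longrightarrow> \<exists>z\<in>D. dist x z < e"
proof -
  fix c :: 'a
  have "\<exists>K. finite K \<and> closure (ball c (real (Suc n))) \<subseteq> (\<Union>x\<in>K. ball x (1 / real (Suc m)))" for n m
  proof -
    have "compact (closure (ball c (real (Suc n))))"
      by (rule compact_closure_ball) simp
    moreover have "0 < 1 / real (Suc m)"
      by simp
    ultimately show ?thesis
      unfolding compact_eq_totally_bounded by blast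
  qed
  then obtain K where K: "\<And>n m. finite (K n m)"
    "\<And>n m. closure (ball c (real (Suc n))) \<subseteq> (\<Union>x\<in>K n m. ball x (1 / real (Suc m)))"
    by metis
  show thesis
  proof
    show "countable (\<Union>n m. K n m)"
      by (intro countable_UN countableI_type countable_finite K(1))
    fix x :: 'a and e :: real assume "0 < e"
    then obtain m where m: "1 / real (Suc m) < e"
      using nat_approx_posE by blast
    obtain n where "dist c x < real (Suc n)"
      using ex_ball by blast
    then have "x \<in> closure (ball c (real (Suc n)))"
      using closure_subset by fastforce
    then obtain z where "z \<in> K n m" "dist z x < 1 / real (Suc m)"
      using K(2) by fastforce
    then show "\<exists>z\<in>\<Union>n m. K n m. dist x z < e"
      using m by (intro bexI[of _ z]) (auto simp: dist_commute)
  qed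
qed

text \<open>Openness alone does not place a set in the sigma-algebra generated by rectangles. A
  countable dense set makes the near diagonal a countable union of products of balls, and this
  measurability underlies every use of Tonelli below.\<close>

lemma near_diagonal_sets [measurable]: "near_diagonal r \<in> sets (M \<Otimes>\<^sub>M M)"
proof -
  obtain D :: "'a set" where D: "countable D" "\<And>x e. 0 < e \<Longrightarrow> \<exists>z\<in>D. dist x z < e"
    using separable by metis
  have "near_diagonal r = (\<Union>z\<in>D. \<Union>q\<in>\<rat>. ball z q \<times> ball z (r - q))"
  proof (intro set_eqI iffI)
    fix w :: "'a \<times> 'a" assume "w \<in> near_diagonal r"
    then obtain x y where w: "w = (x, y)" "dist x y < r"
      by (auto simp: near_diagonal_def)
    \<comment> \<open>Twice the distance from \<open>x\<close> to \<open>z\<close> is below the gap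
      \<open>r - dist x y\<close>, so \<open>dist z x + dist z y < r\<close> and a rational radius
      \<open>q\<close> fits in between.\<close>
    then obtain z where z: "z \<in> D" "dist x z < (r - dist x y) / 2"
      using D(2)[of "(r - dist x y) / 2" x] by auto
    have "dist z y \<le> dist x z + dist x y"
      by (metis dist_commute dist_triangle)
    then have "dist z x < r - dist z y"
      using z(2) by (simp add: dist_commute field_simps)
    then obtain q where "q \<in> \<rat>" "dist z x < q" "q < r - dist z y"
      using Rats_dense_in_real by blast
    then show "w \<in> (\<Union>z\<in>D. \<Union>q\<in>\<rat>. ball z q \<times> ball z (r - q))"
      using w z(1) by (auto intro!: bexI[of _ z] bexI[of _ q])
  next
    fix w :: "'a \<times> 'a" assume "w \<in> (\<Union>z\<in>D. \<Union>q\<in>\<rat>. ball z q \<times> ball z (r - q))"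
    then obtain x y z q where w: "w = (x, y)" "dist z x < q" "dist z y < r - q"
      by auto
    then show "w \<in> near_diagonal r"
      using dist_triangle3[of x y z] by (auto simp: near_diagonal_def)
  qed
  moreover have "(\<Union>z\<in>D. \<Union>q\<in>\<rat>. ball z q \<times> ball z (r - q)) \<in> sets (M \<Otimes>\<^sub>M M)"
    using D(1) countable_rat by (auto intro!: sets.countable_UN' pair_measureI open_in_sets)
  ultimately show ?thesis
    by simp
qed

section \<open>Energy, unweighted variation and the \<open>L\<^sup>1\<close> norm\<close>

text \<open>This is \<open>W r\<close>. It is an iterated integral in the same order as
  \<open>KS_energy\<close>, so the two can be compared integrand by integrand; in the Besov energy
  \<open>y\<close> takes the role of the outer variable.\<close>

definition diagonal_variation :: "('a \<Rightarrow> real) \<Rightarrow> real \<Rightarrow> ennreal" where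
  "diagonal_variation f r =
     (\<integral>\<^sup>+x. (\<integral>\<^sup>+y. ennreal \<bar>f y - f x\<bar> * indicator (near_diagonal r) (x, y) \<partial>M) \<partial>M)"

lemma nn_integral_cmult_variation:
  assumes [measurable]: "f \<in> borel_measurable M"
  shows "(\<integral>\<^sup>+x. (\<integral>\<^sup>+y. c * (ennreal \<bar>f y - f x\<bar> * indicator (near_diagonal r) (x, y)) \<partial>M) \<partial>M)
    = c * diagonal_variation f r"
proof -
  have "(\<integral>\<^sup>+x. (\<integral>\<^sup>+y. c * (ennreal \<bar>f y - f x\<bar> * indicator (near_diagonal r) (x, y)) \<partial>M) \<partial>M)
      = (\<integral>\<^sup>+x. c * (\<integral>\<^sup>+y. ennreal \<bar>f y - f x\<bar> * indicator (near_diagonal r) (x, y) \<partial>M) \<partial>M)"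
    by (intro nn_integral_cong nn_integral_cmult) measurable
  also have "\<dots> = c * diagonal_variation f r"
    unfolding diagonal_variation_def by (rule nn_integral_cmult) measurable
  finally show ?thesis .
qed

text \<open>The lower ball bound makes the weight in the energy at most
  \<open>1 / (c\<^sub>1 * r powr (l + h))\<close>, uniformly in \<open>x\<close>.\<close>

lemma KS_energy_le:
  assumes [measurable]: "f \<in> borel_measurable M" and r: "0 < r"
  shows "KS_energy M l f r \<le> ennreal (1 / (c\<^sub>1 * r powr (l + h))) * diagonal_variation f r"
proof -
  have *: "1 / (ennreal (r powr l) * emeasure M (ball x r)) \<le> ennreal (1 / (c\<^sub>1 * r powr (l + h)))" for x
  proof -
    have "ennreal (c\<^sub>1 * r powr (l + h)) \<le> ennreal (r powr l) * emeasure M (ball x r)"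
      using mult_left_mono[OF ball_lower[OF r, of x], of "ennreal (r powr l)"] c\<^sub>1_pos
      by (simp add: ennreal_mult[symmetric] powr_add mult_ac)
    then have "1 / (ennreal (r powr l) * emeasure M (ball x r)) \<le> 1 / ennreal (c\<^sub>1 * r powr (l + h))"
      by (simp add: divide_ennreal_def inverse_antimono_ennreal)
    also have "\<dots> = ennreal (1 / (c\<^sub>1 * r powr (l + h)))"
      using r c\<^sub>1_pos by (simp flip: ennreal_1 add: divide_ennreal)
    finally show ?thesis .
  qed
  have "KS_energy M l f r \<le> (\<integral>\<^sup>+x. (\<integral>\<^sup>+y. ennreal (1 / (c\<^sub>1 * r powr (l + h))) *
      (ennreal \<bar>f y - f x\<bar> * indicator (near_diagonal r) (x, y)) \<partial>M) \<partial>M)"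
    unfolding KS_energy_def
  proof (intro nn_integral_mono)
    fix x y
    have "ennreal \<bar>f y - f x\<bar> / (ennreal (r powr l) * emeasure M (ball x r))
        = 1 / (ennreal (r powr l) * emeasure M (ball x r)) * ennreal \<bar>f y - f x\<bar>"
      by (simp add: divide_ennreal_def mult_ac)
    also have "\<dots> \<le> ennreal (1 / (c\<^sub>1 * r powr (l + h))) * ennreal \<bar>f y - f x\<bar>"
      by (intro mult_right_mono *) auto
    finally show "ennreal \<bar>f y - f x\<bar> / (ennreal (r powr l) * emeasure M (ball x r)) *
        indicator (near_diagonal r) (x, y) \<le> ennreal (1 / (c\<^sub>1 * r powr (l + h))) *
        (ennreal \<bar>f y - f x\<bar> * indicator (near_diagonal r) (x, y))"
      by (auto split: split_indicator)
  qed
  then show ?thesis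
    by (simp add: nn_integral_cmult_variation)
qed

text \<open>Dually, the upper ball bound makes the weight at least
  \<open>1 / (c\<^sub>2 * r powr (l + h))\<close>.\<close>

lemma variation_le_KS_energy:
  assumes [measurable]: "f \<in> borel_measurable M" and r: "0 < r"
  shows "diagonal_variation f r \<le> ennreal (c\<^sub>2 * r powr (l + h)) * KS_energy M l f r"
proof -
  have *: "ennreal (1 / (c\<^sub>2 * r powr (l + h))) \<le> 1 / (ennreal (r powr l) * emeasure M (ball x r))" for x
  proof -
    have "ennreal (r powr l) * emeasure M (ball x r) \<le> ennreal (c\<^sub>2 * r powr (l + h))"
      using mult_left_mono[OF ball_upper[OF r, of x], of "ennreal (r powr l)"] c\<^sub>2_pos
      by (simp add: ennreal_mult[symmetric] powr_add mult_ac)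
    then have "1 / ennreal (c\<^sub>2 * r powr (l + h)) \<le> 1 / (ennreal (r powr l) * emeasure M (ball x r))"
      by (simp add: divide_ennreal_def inverse_antimono_ennreal)
    moreover have "1 / ennreal (c\<^sub>2 * r powr (l + h)) = ennreal (1 / (c\<^sub>2 * r powr (l + h)))"
      using r c\<^sub>2_pos by (simp flip: ennreal_1 add: divide_ennreal)
    ultimately show ?thesis by simp
  qed
  have "ennreal (1 / (c\<^sub>2 * r powr (l + h))) * diagonal_variation f r
      = (\<integral>\<^sup>+x. (\<integral>\<^sup>+y. ennreal (1 / (c\<^sub>2 * r powr (l + h))) *
      (ennreal \<bar>f y - f x\<bar> * indicator (near_diagonal r) (x, y)) \<partial>M) \<partial>M)"
    by (simp add: nn_integral_cmult_variation)
  also have "\<dots> \<le> KS_energy M l f r"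
    unfolding KS_energy_def
  proof (intro nn_integral_mono)
    fix x y
    have "ennreal (1 / (c\<^sub>2 * r powr (l + h))) * ennreal \<bar>f y - f x\<bar>
        \<le> 1 / (ennreal (r powr l) * emeasure M (ball x r)) * ennreal \<bar>f y - f x\<bar>"
      by (intro mult_right_mono *) auto
    also have "\<dots> = ennreal \<bar>f y - f x\<bar> / (ennreal (r powr l) * emeasure M (ball x r))"
      by (simp add: divide_ennreal_def mult_ac)
    finally show "ennreal (1 / (c\<^sub>2 * r powr (l + h))) *
        (ennreal \<bar>f y - f x\<bar> * indicator (near_diagonal r) (x, y))
        \<le> ennreal \<bar>f y - f x\<bar> / (ennreal (r powr l) * emeasure M (ball x r)) *
        indicator (near_diagonal r) (x, y)"
      by (auto split: split_indicator)
  qed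
  \<comment> \<open>The constant is moved to the other side by multiplication; it cancels because it
    is a positive finite real.\<close>
  finally have "ennreal (c\<^sub>2 * r powr (l + h)) * (ennreal (1 / (c\<^sub>2 * r powr (l + h))) * diagonal_variation f r)
      \<le> ennreal (c\<^sub>2 * r powr (l + h)) * KS_energy M l f r"
    by (intro mult_left_mono) auto
  then show ?thesis
    using r c\<^sub>2_pos by (simp add: mult.assoc[symmetric] ennreal_mult[symmetric])
qed

lemma nn_integral_indicator_near_diagonal:
  "(\<integral>\<^sup>+y. c * indicator (near_diagonal r) (x, y) \<partial>M) = c * emeasure M (ball x r)"
proof -
  have "(\<integral>\<^sup>+y. c * indicator (near_diagonal r) (x, y) \<partial>M) = (\<integral>\<^sup>+y. c * indicator (ball x r) y \<partial>M)"
    by (intro nn_integral_cong) (auto simp: near_diagonal_def split: split_indicator)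
  then show ?thesis
    by (simp add: nn_integral_cmult_indicator open_in_sets)
qed

text \<open>By the triangle inequality the integrand is at most the sum of the values of
  \<open>f\<close> in modulus at both points. Integrating the point not involved over a ball costs
  at most \<open>c\<^sub>2 * r powr h\<close>.\<close>

lemma variation_le_L1:
  assumes [measurable]: "f \<in> borel_measurable M" and r: "0 < r"
  shows "diagonal_variation f r \<le> ennreal (2 * c\<^sub>2 * r powr h) * (\<integral>\<^sup>+x. ennreal \<bar>f x\<bar> \<partial>M)"
proof -
  let ?I = "\<integral>\<^sup>+x. ennreal \<bar>f x\<bar> \<partial>M"
  let ?T = "\<integral>\<^sup>+x. (\<integral>\<^sup>+y. ennreal \<bar>f x\<bar> * indicator (near_diagonal r) (x, y) \<partial>M) \<partial>M"
  let ?S = "\<integral>\<^sup>+x. (\<integral>\<^sup>+y. ennreal \<bar>f y\<bar> * indicator (near_diagonal r) (x, y) \<partial>M) \<partial>M"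
  have "?T \<le> (\<integral>\<^sup>+x. ennreal \<bar>f x\<bar> * ennreal (c\<^sub>2 * r powr h) \<partial>M)"
    unfolding nn_integral_indicator_near_diagonal
    by (intro nn_integral_mono mult_left_mono ball_upper r) auto
  also have "\<dots> = ennreal (c\<^sub>2 * r powr h) * ?I"
    by (simp add: nn_integral_multc mult.commute)
  finally have T: "?T \<le> ennreal (c\<^sub>2 * r powr h) * ?I" .
  \<comment> \<open>Tonelli and the symmetry of the distance reduce the second term to the
    first.\<close>
  have "?S = (\<integral>\<^sup>+y. (\<integral>\<^sup>+x. ennreal \<bar>f y\<bar> * indicator (near_diagonal r) (x, y) \<partial>M) \<partial>M)"
    by (rule Fubini') measurable
  also have "\<dots> = ?T"
    by (intro nn_integral_cong) (auto simp: near_diagonal_def dist_commute split: split_indicator)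
  finally have S: "?S = ?T" .
  have "diagonal_variation f r \<le> (\<integral>\<^sup>+x. (\<integral>\<^sup>+y. ennreal \<bar>f x\<bar> * indicator (near_diagonal r) (x, y)
      + ennreal \<bar>f y\<bar> * indicator (near_diagonal r) (x, y) \<partial>M) \<partial>M)"
    unfolding diagonal_variation_def
    by (intro nn_integral_mono)
       (auto simp: ennreal_plus[symmetric] simp del: ennreal_plus intro!: ennreal_leI split: split_indicator)
  also have "\<dots> = ?T + ?S"
    by (subst nn_integral_add[symmetric], measurable)
       (intro nn_integral_cong nn_integral_add, measurable)
  also have "\<dots> \<le> ennreal (c\<^sub>2 * r powr h) * ?I + ennreal (c\<^sub>2 * r powr h) * ?I"
    unfolding S by (intro add_mono T)
  also have "\<dots> = ennreal (2 * c\<^sub>2 * r powr h) * ?I"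
    using c\<^sub>2_pos by (simp add: distrib_right[symmetric] ennreal_plus[symmetric] del: ennreal_plus)
  finally show ?thesis .
qed

section \<open>From small scales to all scales\<close>

text \<open>The powers \<open>r powr h\<close> from the two preceding bounds cancel. What remains is
  \<open>r powr (- l)\<close>, which is largest at \<open>r = \<delta>\<close>.\<close>

lemma KS_energy_large_scale:
  assumes [measurable]: "f \<in> borel_measurable M" and "0 < \<delta>" "\<delta> \<le> r" "0 \<le> l"
  shows "KS_energy M l f r \<le> ennreal (2 * c\<^sub>2 / c\<^sub>1 * \<delta> powr (- l)) * (\<integral>\<^sup>+x. ennreal \<bar>f x\<bar> \<partial>M)"
proof -
  let ?I = "\<integral>\<^sup>+x. ennreal \<bar>f x\<bar> \<partial>M"
  have r: "0 < r" using assms by simp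
  have "KS_energy M l f r \<le> ennreal (1 / (c\<^sub>1 * r powr (l + h))) * diagonal_variation f r"
    by (rule KS_energy_le) (use r in auto)
  also have "\<dots> \<le> ennreal (1 / (c\<^sub>1 * r powr (l + h))) * (ennreal (2 * c\<^sub>2 * r powr h) * ?I)"
    by (intro mult_left_mono variation_le_L1) (use r in auto)
  also have "\<dots> = ennreal (1 / (c\<^sub>1 * r powr (l + h)) * (2 * c\<^sub>2 * r powr h)) * ?I"
    using c\<^sub>1_pos c\<^sub>2_pos by (subst ennreal_mult) (auto simp: mult.assoc)
  also have "1 / (c\<^sub>1 * r powr (l + h)) * (2 * c\<^sub>2 * r powr h) = 2 * c\<^sub>2 / c\<^sub>1 * r powr (- l)"
    using r c\<^sub>1_pos by (simp add: powr_add powr_minus field_simps)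
  also have "ennreal (2 * c\<^sub>2 / c\<^sub>1 * r powr (- l)) * ?I \<le> ennreal (2 * c\<^sub>2 / c\<^sub>1 * \<delta> powr (- l)) * ?I"
    using assms c\<^sub>1_pos c\<^sub>2_pos
    by (intro mult_right_mono ennreal_leI mult_left_mono powr_mono2') auto
  finally show ?thesis .
qed

text \<open>A finite limsup bounds the energies below some \<delta>, and integrability bounds the
  others. Since \<delta> depends on \<open>f\<close>, this argument compares the spaces and not the
  norms.\<close>

lemma KS_limsup_space_eq:
  assumes "0 \<le> l"
  shows "KS_limsup_space M l = KS_sup_space M l"
proof (intro set_eqI iffI)
  fix f assume "f \<in> KS_sup_space M l"
  moreover have "KS_limsup_norm M l f \<le> KS_sup_norm M l f"
    unfolding KS_limsup_norm_def KS_sup_norm_def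
    by (intro Limsup_bounded) (auto simp: eventually_at_right_field intro!: SUP_upper exI[of _ 1])
  ultimately show "f \<in> KS_limsup_space M l"
    by (auto simp: KS_limsup_space_def KS_sup_space_def)
next
  fix f assume "f \<in> KS_limsup_space M l"
  then have f: "integrable M f" and "KS_limsup_norm M l f < \<infinity>"
    by (auto simp: KS_limsup_space_def)
  then obtain C where "KS_limsup_norm M l f < C" "C < \<infinity>"
    using dense by blast
  then have "eventually (\<lambda>r. KS_energy M l f r < C) (at_right 0)"
    unfolding KS_limsup_norm_def by (intro Limsup_lessD)
  then obtain \<delta> where \<delta>: "0 < \<delta>" "\<And>r. 0 < r \<Longrightarrow> r < \<delta> \<Longrightarrow> KS_energy M l f r < C"
    unfolding eventually_at_right_field by auto
  let ?B = "ennreal (2 * c\<^sub>2 / c\<^sub>1 * \<delta> powr (- l)) * (\<integral>\<^sup>+x. ennreal \<bar>f x\<bar> \<partial>M)"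
  have "KS_energy M l f r \<le> max C ?B" if "0 < r" for r
  proof (cases "r < \<delta>")
    case True
    then show ?thesis using \<delta>(2)[OF that] by (auto simp: le_max_iff_disj)
  next
    case False
    then show ?thesis
      using KS_energy_large_scale[of f \<delta> r l] \<delta>(1) f assms by (auto simp: le_max_iff_disj)
  qed
  then have "KS_sup_norm M l f \<le> max C ?B"
    unfolding KS_sup_norm_def by (intro SUP_least) auto
  also have "\<dots> < \<infinity>"
    using \<open>C < \<infinity>\<close> f by (auto simp: integrable_iff_bounded ennreal_mult_less_top)
  finally show "f \<in> KS_sup_space M l"
    using f by (auto simp: KS_sup_space_def)
qed

section \<open>Comparison with the heat semigroup energy\<close>

text \<open>At time \<open>r powr w\<close> the scaled distance is at most 1 on the near diagonal,
  so the exponential in the lower bound is at least \<open>exp (- c\<^sub>6)\<close> there.\<close>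

lemma KS_sup_le_besov:
  assumes [measurable]: "f \<in> borel_measurable M" and w: "1 < w" and c: "0 < c\<^sub>5" "0 < c\<^sub>6"
    and lower: "AE (x, y) in M \<Otimes>\<^sub>M M. \<forall>t>0.
      c\<^sub>5 * t powr (- h / w) * exp (- c\<^sub>6 * (dist x y powr w / t) powr (1 / (w - 1))) \<le> p t x y"
  shows "KS_sup_norm M l f \<le> ennreal (exp c\<^sub>6 / (c\<^sub>1 * c\<^sub>5)) * besov_norm M p (l / w) f"
  unfolding KS_sup_norm_def
proof (intro SUP_least)
  fix r :: real assume "r \<in> {0<..}"
  then have r: "0 < r" by simp
  define t where "t = r powr w"
  have t: "0 < t" using r by (simp add: t_def)
  have t_powr: "t powr (- h / w) = r powr (- h)" "t powr (- (l / w)) = r powr (- l)"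
    using w by (simp_all add: t_def powr_powr)
  \<comment> \<open>\<open>K\<close> is the resulting lower bound for the kernel on
    \<open>dist x y < r\<close>.\<close>
  define K where "K = c\<^sub>5 * exp (- c\<^sub>6) * r powr (- h)"
  have K: "0 < K" using c r by (simp add: K_def)
  let ?B = "\<integral>\<^sup>+y. (\<integral>\<^sup>+x. ennreal (\<bar>f x - f y\<bar> * p t x y) \<partial>M) \<partial>M"
  have near: "ennreal K * (ennreal \<bar>f x - f y\<bar> * indicator (near_diagonal r) (y, x))
      \<le> ennreal (\<bar>f x - f y\<bar> * p t x y)"
    if "\<forall>t>0. c\<^sub>5 * t powr (- h / w) * exp (- c\<^sub>6 * (dist x y powr w / t) powr (1 / (w - 1))) \<le> p t x y"
    for x y
  proof (cases "dist x y < r")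
    case True
    have "(dist x y powr w / t) powr (1 / (w - 1)) \<le> 1 powr (1 / (w - 1))"
      using True w t unfolding t_def by (intro powr_mono2) (auto intro!: powr_mono2)
    then have "exp (- c\<^sub>6) \<le> exp (- c\<^sub>6 * (dist x y powr w / t) powr (1 / (w - 1)))"
      using c by simp
    then have "c\<^sub>5 * r powr (- h) * exp (- c\<^sub>6)
        \<le> c\<^sub>5 * r powr (- h) * exp (- c\<^sub>6 * (dist x y powr w / t) powr (1 / (w - 1)))"
      using c by (intro mult_left_mono) auto
    then have "K \<le> c\<^sub>5 * t powr (- h / w) * exp (- c\<^sub>6 * (dist x y powr w / t) powr (1 / (w - 1)))"
      unfolding K_def t_powr by (simp add: mult_ac)
    also have "\<dots> \<le> p t x y"
      by (rule that[rule_format, OF t])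
    finally show ?thesis
      using True K by (auto simp: ennreal_mult[symmetric] near_diagonal_def dist_commute mult.commute
          intro!: ennreal_leI mult_right_mono)
  next
    case False
    then show ?thesis by (simp add: near_diagonal_def dist_commute)
  qed
  have "AE y in M. AE x in M. \<forall>t>0.
      c\<^sub>5 * t powr (- h / w) * exp (- c\<^sub>6 * (dist x y powr w / t) powr (1 / (w - 1))) \<le> p t x y"
    by (rule AE_pair_swap[OF lower])
  then have "(\<integral>\<^sup>+y. (\<integral>\<^sup>+x. ennreal K *
      (ennreal \<bar>f x - f y\<bar> * indicator (near_diagonal r) (y, x)) \<partial>M) \<partial>M) \<le> ?B"
    by (rule nn_integral_mono_AE[OF eventually_mono])
      (rule nn_integral_mono_AE[OF eventually_mono], assumption, rule near)
  then have B: "ennreal K * diagonal_variation f r \<le> ?B"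
    by (simp add: nn_integral_cmult_variation)
  define C where "C = exp c\<^sub>6 / (c\<^sub>1 * c\<^sub>5)"
  have C: "0 < C" using c c\<^sub>1_pos by (simp add: C_def)
  \<comment> \<open>The time weight contributes \<open>r powr (- l)\<close> and the kernel
    \<open>r powr (- h)\<close>, which is exactly the scaling of the energy; only \<open>C\<close>
    is left over.\<close>
  have "1 / (c\<^sub>1 * r powr (l + h)) = C * t powr (- (l / w)) * K"
    unfolding K_def C_def t_powr using c c\<^sub>1_pos r by (simp add: powr_add powr_minus exp_minus field_simps)
  then have *: "ennreal (1 / (c\<^sub>1 * r powr (l + h))) * diagonal_variation f r
      = ennreal C * (ennreal (t powr (- (l / w))) * (ennreal K * diagonal_variation f r))"
    using K C by (simp add: ennreal_mult mult.assoc)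
  have "KS_energy M l f r \<le> ennreal (1 / (c\<^sub>1 * r powr (l + h))) * diagonal_variation f r"
    by (rule KS_energy_le) (use r in auto)
  also note *
  also have "ennreal C * (ennreal (t powr (- (l / w))) * (ennreal K * diagonal_variation f r))
      \<le> ennreal C * (ennreal (t powr (- (l / w))) * ?B)"
    by (intro mult_left_mono B) auto
  also have "\<dots> \<le> ennreal C * besov_norm M p (l / w) f"
    unfolding besov_norm_def using t by (intro mult_left_mono SUP_upper) auto
  finally show "KS_energy M l f r \<le> ennreal (exp c\<^sub>6 / (c\<^sub>1 * c\<^sub>5)) * besov_norm M p (l / w) f"
    by (simp add: C_def)
qed

end

section \<open>Dyadic decomposition of the upper heat kernel bound\<close>

text \<open>Decay exponential in \<open>2 ^ k\<close> beats any power of \<open>2 ^ k\<close>. This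
  makes the constant in the upper comparison finite.\<close>

lemma summable_dyadic_exp:
  fixes a c :: real
  assumes "0 < c"
  shows "summable (\<lambda>k. exp (c - c * 2 ^ k / 2) * (2 ^ k) powr a)"
proof (rule summable_comparison_test_bigo)
  show "summable (\<lambda>k. norm ((1 / 2 :: real) ^ k))"
    by (simp add: summable_geometric)
  show "(\<lambda>k. exp (c - c * 2 ^ k / 2) * (2 ^ k) powr a) \<in> O(\<lambda>k. (1 / 2) ^ k)"
    using assms by real_asymp
qed

text \<open>The factor \<open>exp c\<close> makes the summand for \<open>k = 0\<close> at least 1.\<close>

lemma exp_le_dyadic_suminf:
  fixes u c b :: real
  assumes "0 \<le> u" "0 < c" "1 \<le> b" "0 < s"
  shows "ennreal (exp (- c * (u / s) powr b))
    \<le> (\<Sum>k. ennreal (exp (c - c * 2 ^ k / 2)) * indicator {k. u < 2 ^ k * s} k)"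
proof -
  obtain n where "u / s < 2 ^ n"
    using real_arch_pow[of 2 "u / s"] by auto
  then have ex: "\<exists>n. u < 2 ^ n * s"
    using assms by (auto simp: field_simps)
  \<comment> \<open>The first dyadic scale beyond \<open>u\<close>; the single term of the series at
    this index already dominates the left-hand side.\<close>
  define k where "k = (LEAST n. u < 2 ^ n * s)"
  have k: "u < 2 ^ k * s"
    unfolding k_def by (rule LeastI_ex[OF ex])
  \<comment> \<open>For \<open>k = 0\<close> the left side is negative. Otherwise minimality gives
    \<open>2 ^ (k - 1) \<le> u / s\<close>, and raising a number that is at least 1 to the power
    \<open>b\<close> does not decrease it.\<close>
  have "2 ^ k / 2 - 1 \<le> (u / s) powr b"
  proof (cases k)
    case 0
    have "(1 / 2 - 1 :: real) \<le> 0" by simp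
    also have "0 \<le> (u / s) powr b" by simp
    finally show ?thesis by (simp add: 0)
  next
    case (Suc j)
    then have "2 ^ j * s \<le> u"
      using not_less_Least[of j "\<lambda>n. u < 2 ^ n * s"] by (simp add: k_def)
    then have j: "2 ^ j \<le> u / s"
      using assms by (simp add: field_simps)
    have "1 \<le> u / s"
      using j one_le_power[of "2::real" j] by linarith
    then have "u / s \<le> (u / s) powr b"
      using powr_mono[of 1 b "u / s"] assms by (simp add: powr_one)
    with j show ?thesis by (simp add: Suc)
  qed
  then have "c * (2 ^ k / 2 - 1) \<le> c * (u / s) powr b"
    using assms by (intro mult_left_mono) auto
  then have "ennreal (exp (- c * (u / s) powr b)) \<le> ennreal (exp (c - c * 2 ^ k / 2))"
    by (intro ennreal_leI) (simp add: algebra_simps)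
  also have "\<dots> = (\<Sum>i\<in>{k}. ennreal (exp (c - c * 2 ^ i / 2)) * indicator {k. u < 2 ^ k * s} i)"
    using k by simp
  also have "\<dots> \<le> (\<Sum>k. ennreal (exp (c - c * 2 ^ k / 2)) * indicator {k. u < 2 ^ k * s} k)"
    by (intro sum_le_suminf) auto
  finally show ?thesis .
qed

context ahlfors_regular_space
begin

text \<open>With \<open>s = t powr (1 / w)\<close> the upper bound depends on
  \<open>dist x y / s\<close> only, and the dyadic series turns it into a sum of variations at the
  scales \<open>2 ^ k * s\<close>. Each is controlled by the sup norm, with growth
  \<open>(2 ^ k) powr (l + h)\<close> absorbed by the exponential decay.\<close>

lemma besov_le_KS_sup:
  assumes [measurable]: "f \<in> borel_measurable M" and w: "1 < w" and c: "0 < c\<^sub>3" "0 < c\<^sub>4"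
    and upper: "AE (x, y) in M \<Otimes>\<^sub>M M. \<forall>t>0.
      p t x y \<le> c\<^sub>3 * t powr (- h / w) * exp (- c\<^sub>4 * (dist x y powr w / t) powr (1 / (w - 1)))"
  shows "besov_norm M p (l / w) f \<le>
    ennreal (c\<^sub>2 * c\<^sub>3 * (\<Sum>k. exp (c\<^sub>4 - c\<^sub>4 * 2 ^ k / 2) * (2 ^ k) powr (l + h))) * KS_sup_norm M l f"
  unfolding besov_norm_def
proof (intro SUP_least)
  fix t :: real assume "t \<in> {0<..}"
  then have t: "0 < t" by simp
  define s where "s = t powr (1 / w)"
  have s: "0 < s" using t by (simp add: s_def)
  have t_eq: "t = s powr w" using t w by (simp add: s_def powr_powr)
  have t_powr: "t powr (- h / w) = s powr (- h)" "t powr (- (l / w)) = s powr (- l)"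
    using w by (simp_all add: t_eq powr_powr)
  define e where "e k = exp (c\<^sub>4 - c\<^sub>4 * 2 ^ k / 2)" for k :: nat
  have e: "0 < e k" for k by (simp add: e_def)
  define A where "A = c\<^sub>3 * s powr (- h)"
  have A: "0 < A" using c s by (simp add: A_def)
  let ?S = "KS_sup_norm M l f"
  let ?g = "\<lambda>k y x. ennreal (A * e k) * (ennreal \<bar>f x - f y\<bar> * indicator (near_diagonal (2 ^ k * s)) (y, x))"
  have bound: "ennreal (\<bar>f x - f y\<bar> * p t x y) \<le> (\<Sum>k. ?g k y x)"
    if "\<forall>t>0. p t x y \<le> c\<^sub>3 * t powr (- h / w) * exp (- c\<^sub>4 * (dist x y powr w / t) powr (1 / (w - 1)))"
    for x y
  proof -
    have "dist x y powr w / t = (dist x y / s) powr w"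
      using s by (simp add: t_eq powr_divide)
    then have "p t x y \<le> A * exp (- c\<^sub>4 * (dist x y / s) powr (w / (w - 1)))"
      using that[rule_format, OF t] unfolding A_def t_powr by (simp add: powr_powr)
    then have "ennreal (\<bar>f x - f y\<bar> * p t x y)
        \<le> ennreal (\<bar>f x - f y\<bar> * (A * exp (- c\<^sub>4 * (dist x y / s) powr (w / (w - 1)))))"
      by (intro ennreal_leI mult_left_mono) auto
    also have "\<dots> = ennreal \<bar>f x - f y\<bar> * ennreal A * ennreal (exp (- c\<^sub>4 * (dist x y / s) powr (w / (w - 1))))"
      using A by (simp add: ennreal_mult mult.assoc)
    also have "\<dots> \<le> ennreal \<bar>f x - f y\<bar> * ennreal A *
        (\<Sum>k. ennreal (e k) * indicator {k. dist x y < 2 ^ k * s} k)"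
      unfolding e_def using w c s by (intro mult_left_mono exp_le_dyadic_suminf) auto
    also have "\<dots> = (\<Sum>k. ?g k y x)"
      unfolding ennreal_suminf_cmult[symmetric]
      using A e by (intro suminf_cong)
        (auto simp: near_diagonal_def dist_commute ennreal_mult less_imp_le mult_ac split: split_indicator)
    finally show ?thesis .
  qed
  have "AE y in M. AE x in M. \<forall>t>0. p t x y \<le>
      c\<^sub>3 * t powr (- h / w) * exp (- c\<^sub>4 * (dist x y powr w / t) powr (1 / (w - 1)))"
    by (rule AE_pair_swap[OF upper])
  then have "(\<integral>\<^sup>+y. (\<integral>\<^sup>+x. ennreal (\<bar>f x - f y\<bar> * p t x y) \<partial>M) \<partial>M)
      \<le> (\<integral>\<^sup>+y. (\<integral>\<^sup>+x. (\<Sum>k. ?g k y x) \<partial>M) \<partial>M)"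
    by (rule nn_integral_mono_AE[OF eventually_mono])
      (rule nn_integral_mono_AE[OF eventually_mono], assumption, rule bound)
  also have "\<dots> = (\<integral>\<^sup>+y. (\<Sum>k. \<integral>\<^sup>+x. ?g k y x \<partial>M) \<partial>M)"
    by (intro nn_integral_cong nn_integral_suminf) measurable
  also have "\<dots> = (\<Sum>k. \<integral>\<^sup>+y. (\<integral>\<^sup>+x. ?g k y x \<partial>M) \<partial>M)"
    by (intro nn_integral_suminf) measurable
  also have "\<dots> = (\<Sum>k. ennreal (A * e k) * diagonal_variation f (2 ^ k * s))"
    by (simp add: nn_integral_cmult_variation)
  \<comment> \<open>The scales \<open>2 ^ k * s\<close> are unbounded in \<open>k\<close>, so a
    supremum over all radii is what bounds the terms. The factor \<open>s powr (- h)\<close> of the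
    kernel turns \<open>s powr (l + h)\<close> into \<open>s powr l\<close>.\<close>
  also have "\<dots> \<le> (\<Sum>k. ennreal (c\<^sub>2 * c\<^sub>3 * s powr l * (e k * (2 ^ k) powr (l + h))) * ?S)"
  proof (intro suminf_le allI)
    fix k :: nat
    have "diagonal_variation f (2 ^ k * s)
        \<le> ennreal (c\<^sub>2 * (2 ^ k * s) powr (l + h)) * KS_energy M l f (2 ^ k * s)"
      using s by (intro variation_le_KS_energy) auto
    also have "\<dots> \<le> ennreal (c\<^sub>2 * (2 ^ k * s) powr (l + h)) * ?S"
      unfolding KS_sup_norm_def using s by (intro mult_left_mono SUP_upper) auto
    finally have "ennreal (A * e k) * diagonal_variation f (2 ^ k * s)
        \<le> ennreal (A * e k) * (ennreal (c\<^sub>2 * (2 ^ k * s) powr (l + h)) * ?S)"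
      by (intro mult_left_mono) auto
    also have "\<dots> = ennreal (A * e k * (c\<^sub>2 * (2 ^ k * s) powr (l + h))) * ?S"
      using A e c\<^sub>2_pos by (subst ennreal_mult) (auto simp: mult.assoc less_imp_le)
    also have "A * e k * (c\<^sub>2 * (2 ^ k * s) powr (l + h))
        = c\<^sub>2 * c\<^sub>3 * s powr l * (e k * (2 ^ k) powr (l + h))"
      unfolding A_def using s by (simp add: powr_mult powr_add powr_minus field_simps)
    finally show "ennreal (A * e k) * diagonal_variation f (2 ^ k * s)
        \<le> ennreal (c\<^sub>2 * c\<^sub>3 * s powr l * (e k * (2 ^ k) powr (l + h))) * ?S" .
  qed auto
  \<comment> \<open>Summability in the reals lets the series pass inside \<open>ennreal\<close>, so
    the constant is finite.\<close>
  also have "\<dots> = ennreal (\<Sum>k. c\<^sub>2 * c\<^sub>3 * s powr l * (e k * (2 ^ k) powr (l + h))) * ?S"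
    unfolding ennreal_suminf_multc using c c\<^sub>2_pos summable_dyadic_exp[OF c(2), of "l + h"] e
    by (subst suminf_ennreal2) (auto simp: e_def intro!: summable_mult)
  also have "(\<Sum>k. c\<^sub>2 * c\<^sub>3 * s powr l * (e k * (2 ^ k) powr (l + h)))
      = s powr l * (c\<^sub>2 * c\<^sub>3 * (\<Sum>k. e k * (2 ^ k) powr (l + h)))"
    using summable_dyadic_exp[OF c(2), of "l + h"]
    by (subst suminf_mult) (auto simp: e_def mult_ac)
  finally have B: "(\<integral>\<^sup>+y. (\<integral>\<^sup>+x. ennreal (\<bar>f x - f y\<bar> * p t x y) \<partial>M) \<partial>M)
      \<le> ennreal (s powr l * (c\<^sub>2 * c\<^sub>3 * (\<Sum>k. e k * (2 ^ k) powr (l + h)))) * ?S" .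
  have "ennreal (t powr (- (l / w))) * (\<integral>\<^sup>+y. (\<integral>\<^sup>+x. ennreal (\<bar>f x - f y\<bar> * p t x y) \<partial>M) \<partial>M)
      \<le> ennreal (s powr (- l)) *
        (ennreal (s powr l * (c\<^sub>2 * c\<^sub>3 * (\<Sum>k. e k * (2 ^ k) powr (l + h)))) * ?S)"
    unfolding t_powr by (intro mult_left_mono B) auto
  \<comment> \<open>The weight \<open>t powr (- (l / w))\<close> equals \<open>s powr (- l)\<close>
    and removes the last dependence on time.\<close>
  also have "\<dots> = ennreal (c\<^sub>2 * c\<^sub>3 * (\<Sum>k. e k * (2 ^ k) powr (l + h))) * ?S"
    using s by (simp add: mult.assoc[symmetric] ennreal_mult'[symmetric] powr_minus)
  finally show "ennreal (t powr (- (l / w))) *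
      (\<integral>\<^sup>+y. (\<integral>\<^sup>+x. ennreal (\<bar>f x - f y\<bar> * p t x y) \<partial>M) \<partial>M)
      \<le> ennreal (c\<^sub>2 * c\<^sub>3 * (\<Sum>k. exp (c\<^sub>4 - c\<^sub>4 * 2 ^ k / 2) * (2 ^ k) powr (l + h))) * ?S"
    by (simp add: e_def)
qed

end

theorem proposition4p1:
  fixes M :: "'a::metric_space measure"
    and E :: "('a \<Rightarrow> real) \<Rightarrow> ('a \<Rightarrow> real) \<Rightarrow> real"
    and F :: "('a \<Rightarrow> real) set"
    and p :: "real \<Rightarrow> 'a \<Rightarrow> 'a \<Rightarrow> real"
    and d\<^sub>H d\<^sub>W l :: real
  assumes "sub_gaussian_dirichlet_space M E F p d\<^sub>H d\<^sub>W"
    and "0 < l"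
  shows "KS_limsup_space M l = KS_sup_space M l
       \<and> KS_sup_space M l = besov_space M p (l / d\<^sub>W)
       \<and> (\<exists>c>0. \<exists>C>0. \<forall>f\<in>KS_sup_space M l.
            ennreal c * besov_norm M p (l / d\<^sub>W) f \<le> KS_sup_norm M l f \<and>
            KS_sup_norm M l f \<le> ennreal C * besov_norm M p (l / d\<^sub>W) f)"
proof -
  interpret sub_gaussian_dirichlet_space M E F p d\<^sub>H d\<^sub>W by fact
  obtain c\<^sub>1 c\<^sub>2 where c12: "0 < c\<^sub>1" "0 < c\<^sub>2" and balls: "\<And>x r. 0 \<le> r \<Longrightarrow>
      ennreal (c\<^sub>1 * r powr d\<^sub>H) \<le> emeasure M (ball x r) \<and>
      emeasure M (ball x r) \<le> ennreal (c\<^sub>2 * r powr d\<^sub>H)"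
    using ahlfors_regular by blast
  interpret A: ahlfors_regular_space M d\<^sub>H c\<^sub>1 c\<^sub>2
    using radon compact_closure_ball c12 balls
    by unfold_locales (auto simp: radon_measure_def)
  obtain c\<^sub>3 c\<^sub>4 c\<^sub>5 c\<^sub>6 where c: "0 < c\<^sub>3" "0 < c\<^sub>4" "0 < c\<^sub>5" "0 < c\<^sub>6" and
    bounds: "AE (x, y) in M \<Otimes>\<^sub>M M. \<forall>t>0.
      c\<^sub>5 * t powr (- d\<^sub>H / d\<^sub>W) * exp (- c\<^sub>6 * (dist x y powr d\<^sub>W / t) powr (1 / (d\<^sub>W - 1))) \<le> p t x y \<and>
      p t x y \<le> c\<^sub>3 * t powr (- d\<^sub>H / d\<^sub>W) * exp (- c\<^sub>4 * (dist x y powr d\<^sub>W / t) powr (1 / (d\<^sub>W - 1)))"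
    using sub_gaussian_bounds by blast
  have lower: "AE (x, y) in M \<Otimes>\<^sub>M M. \<forall>t>0.
      c\<^sub>5 * t powr (- d\<^sub>H / d\<^sub>W) * exp (- c\<^sub>6 * (dist x y powr d\<^sub>W / t) powr (1 / (d\<^sub>W - 1))) \<le> p t x y"
    by (rule eventually_mono[OF bounds]) blast
  have upper: "AE (x, y) in M \<Otimes>\<^sub>M M. \<forall>t>0.
      p t x y \<le> c\<^sub>3 * t powr (- d\<^sub>H / d\<^sub>W) * exp (- c\<^sub>4 * (dist x y powr d\<^sub>W / t) powr (1 / (d\<^sub>W - 1)))"
    by (rule eventually_mono[OF bounds]) blast
  \<comment> \<open>\<open>C\<close> and \<open>K\<close> are the constants of the two comparison
    lemmas; neither involves \<open>f\<close>.\<close>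
  define C where "C = exp c\<^sub>6 / (c\<^sub>1 * c\<^sub>5)"
  define K where "K = c\<^sub>2 * c\<^sub>3 * (\<Sum>k. exp (c\<^sub>4 - c\<^sub>4 * 2 ^ k / 2) * (2 ^ k) powr (l + d\<^sub>H))"
  have C: "0 < C" using c c12 by (simp add: C_def)
  have K: "0 < K"
    unfolding K_def using c c12 by (intro mult_pos_pos suminf_pos summable_dyadic_exp) auto
  have KS_le: "KS_sup_norm M l f \<le> ennreal C * besov_norm M p (l / d\<^sub>W) f" if "integrable M f" for f
    unfolding C_def using that d\<^sub>W_gt_2 c
    by (intro A.KS_sup_le_besov[OF _ _ _ _ lower]) auto
  have besov_le: "besov_norm M p (l / d\<^sub>W) f \<le> ennreal K * KS_sup_norm M l f" if "integrable M f" for f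
    unfolding K_def using that d\<^sub>W_gt_2 c
    by (intro A.besov_le_KS_sup[OF _ _ _ _ upper]) auto
  \<comment> \<open>Each seminorm is at most a finite constant times the other, so finiteness
    transfers both ways.\<close>
  have "KS_sup_space M l = besov_space M p (l / d\<^sub>W)"
    by (auto simp: KS_sup_space_def besov_space_def ennreal_mult_less_top
        intro!: le_less_trans[OF KS_le] le_less_trans[OF besov_le])
  \<comment> \<open>The lower comparison constant is the reciprocal of \<open>K\<close>, which is
    why \<open>K\<close> had to be positive.\<close>
  moreover have "ennreal (1 / K) * besov_norm M p (l / d\<^sub>W) f \<le> KS_sup_norm M l f"
    if "integrable M f" for f
  proof -
    have "ennreal (1 / K) * besov_norm M p (l / d\<^sub>W) f \<le> ennreal (1 / K) * (ennreal K * KS_sup_norm M l f)"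
      by (intro mult_left_mono besov_le that) auto
    then show ?thesis
      using K by (simp add: mult.assoc[symmetric] ennreal_mult'[symmetric])
  qed
  moreover have "KS_limsup_space M l = KS_sup_space M l"
    using \<open>0 < l\<close> by (intro A.KS_limsup_space_eq) simp
  moreover have "0 < 1 / K"
    using K by simp
  moreover have "integrable M f" if "f \<in> KS_sup_space M l" for f
    using that by (simp add: KS_sup_space_def)
  ultimately show ?thesis
    using KS_le C by blast
qed

end
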